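(* Let $X$ be a Banach space and let $\{S(t)\}_{t\ge 0}$ be a continuous semigroup on $X$ with global attractor $\mathcal{A}$. Assume that there is a projection $P:X\to PX$ of finite rank $\Lambda=\dim PX\ge 1$, and that there exist positive numbers $t_0,M_1,M_2,M_3$ and constants $\lambda_0,\lambda_1\in\mathbb{R}$ such that for all $\varphi,\psi\in\mathcal{A}$ $$\|PS(t_0)\varphi-PS(t_0)\psi\|\le M_1e^{\lambda_0t_0}\|\varphi-\psi\|,$$ $$\|(I-P)S(t_0)\varphi-(I-P)S(t_0)\psi\|\le\left(M_2e^{\lambda_1t_0}+M_3e^{\lambda_0t_0}\right)\|\varphi-\psi\|.$$ Assume also that there exists $0<\alpha<2$ such that $$\alpha M_1e^{\lambda_0t_0}+2M_2e^{\lambda_1t_0}+2M_3e^{\lambda_0t_0}<1.$$ Then the Hausdorff dimension of $\mathcal{A}$ satisfies $$d_H(\mathcal{A})<\frac{-\ln\Lambda-\Lambda\ln\left(2+\frac{4}{\alpha}\right)}{\ln\left(\alpha M_1e^{\lambda_0t_0}+2M_2e^{\lambda_1t_0}+2M_3e^{\lambda_0t_0}\right)}.$$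
   Context: A semigroup on $X$ is a family of (in general nonlinear) maps $S(t):X\to X$, $t\ge 0$, with $S(0)=\mathrm{Id}$ and $S(t+s)=S(t)S(s)$. A set $\mathcal{A}$ is invariant if $S(t)\mathcal{A}=\mathcal{A}$ for all $t\ge 0$. A global attractor is a maximal compact invariant set that attracts each bounded set $B\subset X$. For a compact set $\mathcal{A}\subset X$, $d\ge 0$ and $\varepsilon>0$, let $\mu_H(\mathcal{A},d,\varepsilon)=\inf\sum_i r_i^d$, the infimum being over all coverings of $\mathcal{A}$ by balls of $X$ of radii $r_i\le\varepsilon$; let $\mu_H(\mathcal{A},d)=\lim_{\varepsilon\to0}\mu_H(\mathcal{A},d,\varepsilon)$. The Hausdorff dimension is $d_H(\mathcal{A})=\inf\{d:\mu_H(\mathcal{A},d)=0\}$. "Projection" means a linear projection on $X$. *)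

theory Defs
  imports "HOL-Analysis.Analysis"
begin

(* Time is represented by the type real; only the maps S t with t >= 0 are constrained. *)

definition semigroup_on_space :: "(real \<Rightarrow> 'a \<Rightarrow> 'a) \<Rightarrow> bool" where
  "semigroup_on_space S \<longleftrightarrow>
     (\<forall>x. S 0 x = x) \<and> (\<forall>t\<ge>0. \<forall>s\<ge>0. \<forall>x. S (t + s) x = S t (S s x))"

(* Continuity is required separately in the state and in time, which is implied by
   joint continuity of (t, x) \<mapsto> S t x on [0, infinity) x X. *)
definition continuous_semigroup :: "(real \<Rightarrow> 'a::topological_space \<Rightarrow> 'a) \<Rightarrow> bool" where
  "continuous_semigroup S \<longleftrightarrow>
     semigroup_on_space S \<and>
     (\<forall>t\<ge>0. continuous_on UNIV (S t)) \<and>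
     (\<forall>x. continuous_on {0..} (\<lambda>t. S t x))"

definition invariant_set :: "(real \<Rightarrow> 'a \<Rightarrow> 'a) \<Rightarrow> 'a set \<Rightarrow> bool" where
  "invariant_set S A \<longleftrightarrow> (\<forall>t\<ge>0. S t ` A = A)"

(* The Hausdorff semidistance from S t ` B to A tends to 0 as t \<rightarrow> infinity.
   Stated with neighbourhoods because infdist x {} = 0, which would let the empty set
   attract everything. *)
definition attracts :: "(real \<Rightarrow> 'a::metric_space \<Rightarrow> 'a) \<Rightarrow> 'a set \<Rightarrow> 'a set \<Rightarrow> bool" where
  "attracts S A B \<longleftrightarrow>
     (\<forall>\<epsilon>>0. \<forall>\<^sub>F t in at_top. S t ` B \<subseteq> (\<Union>a\<in>A. ball a \<epsilon>))"

definition global_attractor :: "(real \<Rightarrow> 'a::metric_space \<Rightarrow> 'a) \<Rightarrow> 'a set \<Rightarrow> bool" where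
  "global_attractor S A \<longleftrightarrow>
     compact A \<and> invariant_set S A \<and>
     (\<forall>K. compact K \<and> invariant_set S K \<and> A \<subseteq> K \<longrightarrow> K = A) \<and>
     (\<forall>B. bounded B \<longrightarrow> attracts S A B)"

(* A linear idempotent map with finite-dimensional range; boundedness is not required. *)
definition finite_rank_projection :: "('a::real_vector \<Rightarrow> 'a) \<Rightarrow> bool" where
  "finite_rank_projection P \<longleftrightarrow>
     linear P \<and> P \<circ> P = P \<and> (\<exists>B. finite B \<and> range P = span B)"

(* Coverings are countable (finite ones included): a sum of uncountably many positive
   terms is infinite, so uncountable coverings do not affect the infimum.
   Radii are positive, so that r powr 0 = 1 for every ball of the covering. *)
definition hausdorff_content :: "'a::metric_space set \<Rightarrow> real \<Rightarrow> real \<Rightarrow> ennreal" where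
  "hausdorff_content A d \<epsilon> =
     Inf {(\<Sum>\<^sub>\<infinity>i\<in>I. ennreal (r i powr d)) | (I :: nat set) (c :: nat \<Rightarrow> 'a) (r :: nat \<Rightarrow> real).
            (\<forall>i\<in>I. 0 < r i \<and> r i \<le> \<epsilon>) \<and> A \<subseteq> (\<Union>i\<in>I. ball (c i) (r i))}"

definition hausdorff_measure :: "'a::metric_space set \<Rightarrow> real \<Rightarrow> ennreal" where
  "hausdorff_measure A d = Lim (at_right 0) (hausdorff_content A d)"

(* Extended-real valued, so that the infimum is infinite when no d qualifies. *)
definition hausdorff_dim :: "'a::metric_space set \<Rightarrow> ereal" where
  "hausdorff_dim A = (INF d\<in>{d. 0 \<le> d \<and> hausdorff_measure A d = 0}. ereal d)"

end

theory Submission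
  imports Defs
begin

text \<open>
  Write \<open>f = S t\<^sub>0\<close>, let \<open>a\<close> and \<open>b\<close> be the Lipschitz constants of \<open>P \<circ> f\<close> and
  \<open>(I - P) \<circ> f\<close> on the attractor, and \<open>\<theta> = \<alpha> a + 2 b < 1\<close>, the argument of the logarithm in
  the denominator. Everything rests on one covering step (\<open>image_ball_cover\<close>): the image of the
  part of \<open>A\<close> in a ball of radius \<open>r\<close> centred in \<open>A\<close> is covered by at most
  \<open>N = (1 + 2/\<alpha>)\<^sup>\<Lambda>\<close> balls of radius \<open>\<theta> r\<close>, again centred in \<open>A\<close>. To see this, choose in the
  image a maximal family of points whose \<open>P\<close>-projections are at mutual distance at least
  \<open>\<alpha> a r\<close>. By maximality every image point has projection within \<open>\<alpha> a r\<close> of a chosen one, and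
  the complementary components of two image points always differ by less than \<open>2 b r\<close>. The
  projections lie in a ball of radius \<open>a r\<close> of the \<open>\<Lambda>\<close>-dimensional space \<open>range P\<close>, so a
  packing estimate bounds the size of the family by \<open>N\<close>.

  Since \<open>f\<close> maps \<open>A\<close> onto itself, iteration covers \<open>A\<close> by a constant times \<open>N\<^sup>k\<close> balls of
  radius \<open>\<theta>\<^sup>k\<close> (\<open>iterate_ball_cover\<close>). Hence the Hausdorff measure in dimension \<open>d\<close> vanishes
  as soon as \<open>N \<theta>\<^sup>d < 1\<close>, that is, \<open>d > \<Lambda> ln (1 + 2/\<alpha>) / (- ln \<theta>)\<close>. This threshold is
  strictly below the asserted bound because \<open>1 + 2/\<alpha> < 2 + 4/\<alpha>\<close>, so there is room for such a
  \<open>d\<close> between the two.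

  The packing estimate is \<open>card_separated_in_ball_le\<close>: an
  \<open>\<epsilon>\<close>-separated set in a ball of radius \<open>R\<close> of a \<open>k\<close>-dimensional normed space has at most
  \<open>(1 + 2R/\<epsilon>)\<^sup>k\<close> points. It is usually proved by comparing volumes. Here a crude estimate
  \<open>C (R/\<delta>)\<^sup>k\<close> with an unspecified \<open>C\<close> (\<open>span_ball_finite_net\<close>, from a grid in coordinates) is
  sharpened by self-similarity: a packing of \<open>m\<close> balls of relative radius \<open>\<rho>\<close> can be repeated
  inside each of its balls, which gives \<open>m\<^sup>j\<close> balls of relative radius \<open>\<rho>\<^sup>j\<close>. Comparing with the
  crude estimate and letting \<open>j\<close> tend to infinity removes the constant.
\<close>

section \<open>Nets in finite-dimensional subspaces\<close>

text \<open>
  A positive distance from \<open>e\<close> to \<open>V\<close> makes the coordinate along \<open>e\<close> a bounded functional.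
  This replaces the equivalence of norms in finite dimension, and allows induction on a basis.
\<close>

lemma abs_coeff_infdist_le:
  fixes e :: "'a::real_normed_vector"
  assumes "subspace V" "y \<in> V"
  shows "\<bar>c\<bar> * infdist e V \<le> norm (c *\<^sub>R e + y)"
proof (cases "c = 0")
  case False
  have "(- 1 / c) *\<^sub>R y \<in> V"
    using assms by (simp add: subspace_scale subspace_neg)
  then have "infdist e V \<le> dist e ((- 1 / c) *\<^sub>R y)"
    by (rule infdist_le)
  also have "\<dots> = norm ((1 / c) *\<^sub>R (c *\<^sub>R e + y))"
    using False by (simp add: dist_norm algebra_simps)
  also have "\<dots> = norm (c *\<^sub>R e + y) / \<bar>c\<bar>"
    by (simp add: divide_inverse)
  finally show ?thesis
    using False by (simp add: field_simps)
qed simp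

text \<open>
  Completeness of \<open>span B\<close> gives closedness, hence a positive distance from a new basis vector \<open>e\<close>
  to \<open>span B\<close>. By the coordinate bound, the coefficients along \<open>e\<close> of a Cauchy sequence are then
  Cauchy as well, and so is the remaining part in \<open>span B\<close>.
\<close>

lemma complete_span_finite:
  fixes B :: "'a::real_normed_vector set"
  assumes "finite B"
  shows "complete (span B)"
  using assms
proof (induction B rule: finite_induct)
  case empty
  then show ?case by (simp add: finite_imp_compact compact_imp_complete)
next
  case (insert e B)
  show ?case
  proof (cases "e \<in> span B")
    case True
    then show ?thesis using insert.IH by (simp add: span_redundant)
  next
    case False
    define d where "d = infdist e (span B)"
    have ne: "span B \<noteq> {}" using span_zero by blast
    have d: "d > 0"
      unfolding d_def
      by (rule infdist_pos_not_in_closed[OF complete_imp_closed[OF insert.IH] ne False])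
    show ?thesis
      unfolding complete_def
    proof (intro allI impI, elim conjE)
      fix x assume x: "\<forall>n. x n \<in> span (insert e B)" and Cx: "Cauchy x"
      have "\<forall>n. \<exists>k. x n - k *\<^sub>R e \<in> span B"
        using x span_breakdown_eq by blast
      then obtain c where c: "\<And>n. x n - c n *\<^sub>R e \<in> span B" by metis
      have cd: "\<bar>c m - c n\<bar> * d \<le> norm (x m - x n)" for m n
      proof -
        have "(x m - c m *\<^sub>R e) - (x n - c n *\<^sub>R e) \<in> span B"
          using c span_diff by blast
        from abs_coeff_infdist_le[OF subspace_span this, of "c m - c n" e]
        show ?thesis by (simp add: d_def algebra_simps)
      qed
      have "Cauchy c"
      proof (rule metric_CauchyI)
        fix \<epsilon> :: real assume "\<epsilon> > 0"
        then have "\<epsilon> * d > 0" using d by simp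
        then obtain N where N: "\<forall>m\<ge>N. \<forall>n\<ge>N. dist (x m) (x n) < \<epsilon> * d"
          using metric_CauchyD[OF Cx] by meson
        have "dist (c m) (c n) < \<epsilon>" if "m \<ge> N" "n \<ge> N" for m n
        proof -
          have "\<bar>c m - c n\<bar> * d < \<epsilon> * d"
            using cd[of m n] N that by (force simp: dist_norm)
          then show ?thesis using d by (simp add: dist_real_def)
        qed
        then show "\<exists>M. \<forall>m\<ge>M. \<forall>n\<ge>M. dist (c m) (c n) < \<epsilon>" by blast
      qed
      then obtain l where l: "c \<longlonglongrightarrow> l"
        using Cauchy_convergent_iff convergent_def by blast
      then have le: "(\<lambda>n. c n *\<^sub>R e) \<longlonglongrightarrow> l *\<^sub>R e"
        by (intro tendsto_intros)
      then have Ce: "Cauchy (\<lambda>n. c n *\<^sub>R e)" by (rule LIMSEQ_imp_Cauchy)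
      have "Cauchy (\<lambda>n. x n - c n *\<^sub>R e)"
      proof (rule metric_CauchyI)
        fix \<epsilon> :: real assume "\<epsilon> > 0"
        then have e2: "\<epsilon> / 2 > 0" by simp
        obtain K where K: "\<And>m n. m \<ge> K \<Longrightarrow> n \<ge> K \<Longrightarrow> dist (x m) (x n) < \<epsilon> / 2"
          using metric_CauchyD[OF Cx e2] by blast
        obtain K' where K': "\<And>m n. m \<ge> K' \<Longrightarrow> n \<ge> K' \<Longrightarrow> dist (c m *\<^sub>R e) (c n *\<^sub>R e) < \<epsilon> / 2"
          using metric_CauchyD[OF Ce e2] by blast
        have "dist (x m - c m *\<^sub>R e) (x n - c n *\<^sub>R e) < \<epsilon>"
          if "m \<ge> max K K'" "n \<ge> max K K'" for m n
          using K[of m n] K'[of m n] that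
            norm_diff_triangle_ineq[of "x m" "c n *\<^sub>R e" "x n" "c m *\<^sub>R e"]
            norm_triangle_ineq4[of "x m - x n" "c m *\<^sub>R e - c n *\<^sub>R e"]
          by (simp add: dist_norm algebra_simps)
        then show "\<exists>M. \<forall>m\<ge>M. \<forall>n\<ge>M. dist (x m - c m *\<^sub>R e) (x n - c n *\<^sub>R e) < \<epsilon>"
          by blast
      qed
      then obtain y where y: "y \<in> span B" "(\<lambda>n. x n - c n *\<^sub>R e) \<longlonglongrightarrow> y"
        using insert.IH[unfolded complete_def, rule_format, of "\<lambda>n. x n - c n *\<^sub>R e"] c by auto
      have "x \<longlonglongrightarrow> y + l *\<^sub>R e"
        using tendsto_add[OF y(2) le] by simp
      moreover have "y + l *\<^sub>R e \<in> span (insert e B)"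
        using y(1) by (auto simp: span_breakdown_eq intro!: exI[of _ l])
      ultimately show "\<exists>l\<in>span (insert e B). x \<longlonglongrightarrow> l" by blast
    qed
  qed
qed

text \<open>
  Adding a basis vector \<open>e\<close> multiplies a net by a grid of coefficients along \<open>e\<close>; these range over
  an interval of length proportional to \<open>R\<close>, so of the order of \<open>R/\<delta>\<close> grid points suffice. Only
  the exponent matters later, so the constant is left unspecified.
\<close>

lemma span_ball_finite_net:
  fixes B :: "'a::real_normed_vector set"
  assumes "finite B" "independent B"
  shows "\<exists>C>0. \<forall>R \<delta>. 0 < \<delta> \<longrightarrow> \<delta> \<le> R \<longrightarrow>
           (\<exists>F. finite F \<and> real (card F) \<le> C * (R / \<delta>) ^ card B \<and>
                span B \<inter> cball 0 R \<subseteq> (\<Union>f\<in>F. cball f \<delta>))"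
  using assms
proof (induction B rule: finite_induct)
  case empty
  show ?case
    by (intro exI[of _ "1::real"] conjI allI impI exI[of _ "{0}"]) auto
next
  case (insert e B)
  have ind: "independent B" and e: "e \<notin> span B"
    using insert by (auto simp: independent_insert)
  obtain C where C: "C > 0" "\<And>R \<delta>. 0 < \<delta> \<Longrightarrow> \<delta> \<le> R \<Longrightarrow>
           \<exists>F. finite F \<and> real (card F) \<le> C * (R / \<delta>) ^ card B \<and>
                span B \<inter> cball 0 R \<subseteq> (\<Union>f\<in>F. cball f \<delta>)"
    using insert.IH[OF ind] by blast
  have e0: "norm e > 0" using e span_zero by auto
  define d where "d = infdist e (span B)"
  have ne: "span B \<noteq> {}" using span_zero by blast
  have d: "d > 0"
    unfolding d_def
    by (rule infdist_pos_not_in_closed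
        [OF complete_imp_closed[OF complete_span_finite[OF insert.hyps(1)]] ne e])
  \<comment> \<open>A point of norm at most \<open>R\<close> has coefficient at most \<open>R / d\<close> along \<open>e\<close>, so its component in
    \<open>span B\<close> has norm at most \<open>R * q\<close>.\<close>
  define q where "q = 1 + norm e / d"
  define C' where "C' = (4 * norm e / d + 3) * (C * (2 * q) ^ card B)"
  have q: "q \<ge> 1" using d by (simp add: q_def)
  have a0: "4 * norm e / d + 3 > 0" using d by (simp add: add_nonneg_pos)
  have C'0: "C' > 0" using a0 C(1) q by (simp add: C'_def)
  show ?case
  proof (intro exI[of _ C'] conjI allI impI)
    fix R \<delta> :: real assume \<delta>: "0 < \<delta>" "\<delta> \<le> R"
    have R: "R > 0" using \<delta> by simp
    have "R \<le> R * q" using q R by simp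
    then have "\<delta> / 2 \<le> R * q" using \<delta> by linarith
    then obtain F where F: "finite F" "real (card F) \<le> C * (R * q / (\<delta> / 2)) ^ card B"
        "span B \<inter> cball 0 (R * q) \<subseteq> (\<Union>f\<in>F. cball f (\<delta> / 2))"
      using C(2)[of "\<delta> / 2" "R * q"] \<delta> by auto
    \<comment> \<open>Half of the error \<open>\<delta>\<close> is spent on rounding the coefficient to a multiple of \<open>\<eta>\<close>, half on
      the net in \<open>span B\<close>.\<close>
    define \<eta> where "\<eta> = \<delta> / (2 * norm e)"
    have \<eta>: "\<eta> > 0" using \<delta> e0 by (simp add: \<eta>_def)
    define M where "M = R / d / \<eta>"
    have M0: "M \<ge> 0" using R d \<eta> by (simp add: M_def)
    define J where "J = {-\<lceil>M\<rceil>..\<lceil>M\<rceil>}"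
    define G where "G = (\<lambda>(j, f). (of_int j * \<eta>) *\<^sub>R e + f) ` (J \<times> F)"
    have finG: "finite G" using F(1) by (simp add: G_def J_def)
    have "real (card J) = 2 * of_int \<lceil>M\<rceil> + 1"
      using M0 by (simp add: J_def)
    also have "\<dots> \<le> 2 * M + 3" using ceiling_correct[of M] by linarith
    also have "\<dots> \<le> (4 * norm e / d) * (R / \<delta>) + 3 * (R / \<delta>)"
    proof -
      have "2 * M = (4 * norm e / d) * (R / \<delta>)" by (simp add: M_def \<eta>_def mult_ac)
      moreover have "1 \<le> R / \<delta>" using \<delta> by simp
      ultimately show ?thesis by linarith
    qed
    also have "\<dots> = (4 * norm e / d + 3) * (R / \<delta>)" by (simp add: algebra_simps)
    finally have J: "real (card J) \<le> (4 * norm e / d + 3) * (R / \<delta>)" .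
    have "real (card G) \<le> real (card J) * real (card F)"
    proof -
      have "card G \<le> card (J \<times> F)"
        unfolding G_def by (rule card_image_le) (simp add: F(1) J_def)
      then have "real (card G) \<le> real (card (J \<times> F))" by (rule of_nat_mono)
      then show ?thesis by (simp add: card_cartesian_product)
    qed
    also have "\<dots> \<le> ((4 * norm e / d + 3) * (R / \<delta>)) * (C * (R * q / (\<delta> / 2)) ^ card B)"
      using J F(2) by (intro mult_mono) auto
    also have "\<dots> = C' * (R / \<delta>) ^ card (insert e B)"
    proof -
      have "R * q / (\<delta> / 2) = (2 * q) * (R / \<delta>)" by simp
      then have "(R * q / (\<delta> / 2)) ^ card B = (2 * q) ^ card B * (R / \<delta>) ^ card B"
        by (simp only: power_mult_distrib)
      then show ?thesis using insert.hyps by (simp add: C'_def)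
    qed
    finally have cardG: "real (card G) \<le> C' * (R / \<delta>) ^ card (insert e B)" .
    have "span (insert e B) \<inter> cball 0 R \<subseteq> (\<Union>f\<in>G. cball f \<delta>)"
    proof
      fix x assume x: "x \<in> span (insert e B) \<inter> cball 0 R"
      then obtain c where c: "x - c *\<^sub>R e \<in> span B"
        using span_breakdown_eq by blast
      define y where "y = x - c *\<^sub>R e"
      have xy: "x = c *\<^sub>R e + y" by (simp add: y_def)
      have yB: "y \<in> span B" using c by (simp add: y_def)
      have "\<bar>c\<bar> * d \<le> R"
        using abs_coeff_infdist_le[OF subspace_span yB, of c e] x by (simp add: d_def xy)
      then have cR: "\<bar>c\<bar> \<le> R / d" using d by (simp add: field_simps)
      have "norm y \<le> norm x + norm (c *\<^sub>R e)"
        unfolding y_def by (rule norm_triangle_ineq4)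
      also have "\<dots> \<le> R + (R / d) * norm e"
        using x mult_right_mono[OF cR norm_ge_zero[of e]] by (intro add_mono) auto
      also have "\<dots> = R * q" by (simp add: q_def algebra_simps)
      finally have "y \<in> span B \<inter> cball 0 (R * q)" using yB by simp
      then obtain f where f: "f \<in> F" "dist f y \<le> \<delta> / 2" using F(3) by auto
      define j where "j = \<lfloor>c / \<eta>\<rfloor>"
      have "\<bar>c / \<eta>\<bar> \<le> M"
        using divide_right_mono[OF cR, of \<eta>] \<eta> by (simp add: M_def)
      then have "j \<in> J" unfolding J_def j_def by (simp; linarith)
      then have "(of_int j * \<eta>) *\<^sub>R e + f \<in> G" using f by (force simp: G_def)
      moreover have "dist ((of_int j * \<eta>) *\<^sub>R e + f) x \<le> \<delta>"
      proof -
        have "\<bar>c / \<eta> - of_int j\<bar> \<le> 1" unfolding j_def by linarith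
        then have "\<bar>c / \<eta> - of_int j\<bar> * \<eta> \<le> 1 * \<eta>" using \<eta> by (intro mult_right_mono) auto
        moreover have "\<bar>c / \<eta> - of_int j\<bar> * \<eta> = \<bar>of_int j * \<eta> - c\<bar>"
        proof -
          have "\<bar>c / \<eta> - of_int j\<bar> * \<eta> = \<bar>(c / \<eta> - of_int j) * \<eta>\<bar>"
            using \<eta> by (simp add: abs_mult)
          also have "\<dots> = \<bar>of_int j * \<eta> - c\<bar>"
            using \<eta> by (simp add: left_diff_distrib abs_minus_commute)
          finally show ?thesis .
        qed
        ultimately have "\<bar>of_int j * \<eta> - c\<bar> * norm e \<le> \<eta> * norm e"
          using e0 by (intro mult_right_mono) auto
        also have "\<dots> = \<delta> / 2" using e0 by (simp add: \<eta>_def)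
        finally have "norm ((of_int j * \<eta> - c) *\<^sub>R e) \<le> \<delta> / 2" by simp
        moreover have "norm (f - y) \<le> \<delta> / 2" using f by (simp add: dist_norm)
        moreover have "((of_int j * \<eta>) *\<^sub>R e + f) - x = (of_int j * \<eta> - c) *\<^sub>R e + (f - y)"
          by (simp add: xy algebra_simps)
        ultimately show ?thesis
          unfolding dist_norm
          by (metis (no_types, lifting) add_mono field_sum_of_halves norm_triangle_le)
      qed
      ultimately show "x \<in> (\<Union>f\<in>G. cball f \<delta>)" by auto
    qed
    then show "\<exists>F. finite F \<and> real (card F) \<le> C' * (R / \<delta>) ^ card (insert e B) \<and>
                span (insert e B) \<inter> cball 0 R \<subseteq> (\<Union>f\<in>F. cball f \<delta>)"
      using finG cardG by blast
  qed (rule C'0)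
qed

section \<open>Packing by a self-similar construction\<close>

lemma card_separated_le_card_net:
  fixes T F :: "'a::metric_space set"
  assumes "finite F" "T \<subseteq> (\<Union>f\<in>F. cball f \<delta>)" "pairwise (\<lambda>x y. 2 * \<delta> < dist x y) T"
  shows "card T \<le> card F"
proof -
  have "\<forall>t\<in>T. \<exists>f. f \<in> F \<and> dist f t \<le> \<delta>" using assms(2) by force
  then obtain g where g: "\<And>t. t \<in> T \<Longrightarrow> g t \<in> F \<and> dist (g t) t \<le> \<delta>" by metis
  have "inj_on g T"
  proof (rule inj_onI, rule ccontr)
    fix x y assume xy: "x \<in> T" "y \<in> T" "g x = g y" "x \<noteq> y"
    have "dist x y \<le> dist (g x) x + dist (g x) y" by (rule dist_triangle3)
    also have "\<dots> \<le> 2 * \<delta>" using g[OF xy(1)] g[OF xy(2)] xy(3) by simp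
    also have "\<dots> < dist x y" using assms(3) xy by (simp add: pairwise_def)
    finally show False by simp
  qed
  then show ?thesis
    using g assms(1) by (intro card_inj_on_le[of g]) auto
qed

text \<open>
  The balls of radius \<open>\<epsilon>/2\<close> about the points of \<open>T\<close> are disjoint and lie in the ball of radius
  \<open>L = R + \<epsilon>/2\<close>; their relative radius is \<open>\<rho>\<close>. Replacing each of them by a copy of the whole
  configuration scaled by \<open>\<rho>\<close>, and repeating this \<open>k\<close> times, gives disjoint balls of radius
  \<open>L \<rho>\<^sup>k\<close> inside the ball of radius \<open>L\<close>. The set \<open>U\<close> consists of their centres, which explains
  both the norm bound and the separation. The invariants are exact because \<open>\<rho> L = \<epsilon>/2\<close>.
\<close>

lemma self_similar_packing:
  fixes T :: "'a::real_normed_vector set"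
  assumes "subspace V" "finite T" "T \<subseteq> V \<inter> cball 0 R" "0 \<le> R" "0 < \<epsilon>"
    and sep: "pairwise (\<lambda>x y. \<epsilon> \<le> dist x y) T"
    and L_def: "L = R + \<epsilon> / 2" and \<rho>_def: "\<rho> = \<epsilon> / (2 * R + \<epsilon>)"
  shows "\<exists>U. U \<subseteq> V \<inter> cball 0 (L - L * \<rho> ^ k) \<and> finite U \<and> card U = card T ^ k \<and>
             pairwise (\<lambda>x y. 2 * L * \<rho> ^ k \<le> dist x y) U"
proof (induction k)
  case 0
  show ?case
    using assms(1) by (intro exI[of _ "{0}"]) (auto simp: subspace_0)
next
  case (Suc k)
  then obtain U where U: "U \<subseteq> V \<inter> cball 0 (L - L * \<rho> ^ k)" "finite U" "card U = card T ^ k"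
    and sepU: "pairwise (\<lambda>x y. 2 * L * \<rho> ^ k \<le> dist x y) U" by blast
  have L: "L > 0" using assms(4,5) by (simp add: L_def)
  have \<rho>: "\<rho> > 0" using assms(4,5) by (simp add: \<rho>_def)
  have \<rho>L: "\<rho> * L = \<epsilon> / 2" using assms(4,5) by (simp add: \<rho>_def L_def field_simps)
  define h where "h = (\<lambda>(x::'a, u). x + \<rho> *\<^sub>R u)"
  have dU: "norm (u - v) \<le> 2 * (L - L * \<rho> ^ k)" if "u \<in> U" "v \<in> U" for u v
  proof -
    have "norm u \<le> L - L * \<rho> ^ k" "norm v \<le> L - L * \<rho> ^ k" using that U(1) by auto
    then have "norm (u - v) \<le> (L - L * \<rho> ^ k) + (L - L * \<rho> ^ k)"
      by (rule order_trans[OF norm_triangle_ineq4 add_mono])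
    then show ?thesis by simp
  qed
  have far: "2 * L * \<rho> ^ Suc k \<le> dist (h (x, u)) (h (y, v))"
    if "x \<in> T" "y \<in> T" "u \<in> U" "v \<in> U" "(x, u) \<noteq> (y, v)" for x y u v
  proof (cases "x = y")
    case True
    then have "2 * L * \<rho> ^ k \<le> dist u v" using that sepU by (auto simp: pairwise_def)
    then have "\<rho> * (2 * L * \<rho> ^ k) \<le> \<rho> * dist u v" using \<rho> by (intro mult_left_mono) auto
    also have "\<rho> * dist u v = norm (\<rho> *\<^sub>R (u - v))" using \<rho> by (simp add: dist_norm)
    also have "\<rho> *\<^sub>R (u - v) = h (x, u) - h (y, v)" using True by (simp add: h_def algebra_simps)
    finally show ?thesis by (simp add: dist_norm algebra_simps)
  next
    case False
    have "\<rho> * (2 * (L - L * \<rho> ^ k)) = 2 * (\<rho> * L) - 2 * L * \<rho> ^ Suc k"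
      by (simp add: algebra_simps)
    also have "2 * (\<rho> * L) = \<epsilon>" using \<rho>L by simp
    finally have "2 * L * \<rho> ^ Suc k = \<epsilon> - \<rho> * (2 * (L - L * \<rho> ^ k))"
      by (simp only: diff_diff_eq2 add_diff_cancel_left')
    also have "\<dots> \<le> norm (x - y) - norm (\<rho> *\<^sub>R (v - u))"
    proof (rule diff_mono)
      show "\<epsilon> \<le> norm (x - y)" using False that sep by (auto simp: pairwise_def dist_norm)
      show "norm (\<rho> *\<^sub>R (v - u)) \<le> \<rho> * (2 * (L - L * \<rho> ^ k))"
        using dU[OF that(4,3)] \<rho> by simp
    qed
    also have "\<dots> \<le> norm ((x - y) - \<rho> *\<^sub>R (v - u))"
      by (rule norm_triangle_ineq2)
    also have "(x - y) - \<rho> *\<^sub>R (v - u) = h (x, u) - h (y, v)"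
      by (simp add: h_def algebra_simps)
    finally show ?thesis by (simp only: dist_norm)
  qed
  have pos: "2 * L * \<rho> ^ Suc k > 0" using L \<rho> by simp
  have inj: "inj_on h (T \<times> U)"
  proof (rule inj_onI, rule ccontr)
    fix p q assume pq: "p \<in> T \<times> U" "q \<in> T \<times> U" "h p = h q" "p \<noteq> q"
    obtain x u y v where "p = (x, u)" "q = (y, v)" by (metis surj_pair)
    then show False using far[of x y u v] pos pq by (simp del: power_Suc)
  qed
  have "h ` (T \<times> U) \<subseteq> V \<inter> cball 0 (L - L * \<rho> ^ Suc k)"
  proof clarify
    fix x u assume xu: "x \<in> T" "u \<in> U"
    have "norm (h (x, u)) \<le> norm x + norm (\<rho> *\<^sub>R u)"
      by (simp only: h_def prod.case norm_triangle_ineq)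
    also have "\<dots> \<le> R + \<rho> * (L - L * \<rho> ^ k)"
      using xu assms(3) U(1) \<rho> by (intro add_mono) auto
    also have "\<dots> = R + \<rho> * L - L * \<rho> ^ Suc k" by (simp add: algebra_simps)
    also have "\<dots> = L - L * \<rho> ^ Suc k" by (simp only: \<rho>L) (simp add: L_def)
    finally have "norm (h (x, u)) \<le> L - L * \<rho> ^ Suc k" .
    moreover have "h (x, u) \<in> V"
      using xu assms(1,3) U(1) by (auto simp: h_def intro!: subspace_add subspace_scale)
    ultimately show "h (x, u) \<in> V \<inter> cball 0 (L - L * \<rho> ^ Suc k)" by simp
  qed
  moreover have "card (h ` (T \<times> U)) = card T ^ Suc k"
    using inj U(3) by (simp add: card_image card_cartesian_product)
  moreover have "pairwise (\<lambda>x y. 2 * L * \<rho> ^ Suc k \<le> dist x y) (h ` (T \<times> U))"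
    unfolding pairwise_def using far by (auto simp del: power_Suc)
  ultimately show ?case using assms(2) U(2) by (intro exI[of _ "h ` (T \<times> U)"]) auto
qed

text \<open>
  With \<open>\<rho> = 1 / (1 + 2R/\<epsilon>)\<close> and \<open>m\<close> points in \<open>T\<close>, the crude net estimate applied to the \<open>m\<^sup>k\<close>
  points of the \<open>k\<close>-th self-similar packing bounds \<open>(m \<rho>\<^bsup>dim\<^esup>)\<^sup>k\<close> independently of \<open>k\<close>. Bounded
  powers force \<open>m \<rho>\<^bsup>dim\<^esup> \<le> 1\<close>.
\<close>

lemma card_separated_in_ball_le:
  fixes T :: "'a::real_normed_vector set"
  assumes "finite B" "independent B" "finite T" "T \<subseteq> span B \<inter> cball p R" "p \<in> span B"
    and "0 \<le> R" "0 < \<epsilon>" and sep: "pairwise (\<lambda>x y. \<epsilon> \<le> dist x y) T"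
  shows "real (card T) \<le> (1 + 2 * R / \<epsilon>) ^ card B"
proof -
  define T' where "T' = (\<lambda>x. x - p) ` T"
  have cT: "card T' = card T" unfolding T'_def by (intro card_image inj_onI) simp
  have T': "finite T'" "T' \<subseteq> span B \<inter> cball 0 R" "pairwise (\<lambda>x y. \<epsilon> \<le> dist x y) T'"
    using assms by (auto simp: T'_def pairwise_def dist_norm span_diff norm_minus_commute)
  define L where "L = R + \<epsilon> / 2"
  define \<rho> where "\<rho> = \<epsilon> / (2 * R + \<epsilon>)"
  have L: "L > 0" using assms by (simp add: L_def)
  have \<rho>: "0 < \<rho>" "\<rho> \<le> 1" using assms by (simp_all add: \<rho>_def)
  obtain C where C: "C > 0" "\<And>R \<delta>. 0 < \<delta> \<Longrightarrow> \<delta> \<le> R \<Longrightarrow>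
           \<exists>F. finite F \<and> real (card F) \<le> C * (R / \<delta>) ^ card B \<and>
                span B \<inter> cball 0 R \<subseteq> (\<Union>f\<in>F. cball f \<delta>)"
    using span_ball_finite_net[OF assms(1,2)] by blast
  have bound: "(real (card T) * \<rho> ^ card B) ^ k \<le> C * 2 ^ card B" for k
  proof -
    obtain U where U: "U \<subseteq> span B \<inter> cball 0 (L - L * \<rho> ^ k)" "card U = card T ^ k"
        "pairwise (\<lambda>x y. 2 * L * \<rho> ^ k \<le> dist x y) U"
      using self_similar_packing[OF subspace_span T'(1,2) assms(6,7) T'(3) L_def \<rho>_def, of k]
      unfolding cT by blast
    \<comment> \<open>The net must be finer than half the separation \<open>2 * L * \<rho> ^ k\<close>, strictly, so that no two
      points of \<open>U\<close> share a net point.\<close>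
    define \<delta> where "\<delta> = L * \<rho> ^ k / 2"
    have pw: "0 < \<rho> ^ k" "\<rho> ^ k \<le> 1" using \<rho> by (auto intro: power_le_one)
    have \<delta>: "0 < \<delta>" using L pw by (simp add: \<delta>_def)
    have "L * \<rho> ^ k \<le> L" using L pw by simp
    then have "\<delta> \<le> L" using L by (simp add: \<delta>_def)
    then obtain F where F: "finite F" "real (card F) \<le> C * (L / \<delta>) ^ card B"
        "span B \<inter> cball 0 L \<subseteq> (\<Union>f\<in>F. cball f \<delta>)"
      using C(2)[OF \<delta>] by blast
    have "card U \<le> card F"
    proof (rule card_separated_le_card_net[OF F(1)])
      have "L - L * \<rho> ^ k \<le> L" using L pw by simp
      then have "cball 0 (L - L * \<rho> ^ k) \<subseteq> cball (0::'a) L" by (rule subset_cball)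
      then show "U \<subseteq> (\<Union>f\<in>F. cball f \<delta>)" using U(1) F(3) by blast
      have "2 * \<delta> < 2 * L * \<rho> ^ k" using L pw by (simp add: \<delta>_def)
      then show "pairwise (\<lambda>x y. 2 * \<delta> < dist x y) U"
        using U(3) by (force simp: pairwise_def)
    qed
    then have "real (card T) ^ k \<le> real (card F)"
      using U(2) by (metis of_nat_le_iff of_nat_power)
    also have "\<dots> \<le> C * (L / \<delta>) ^ card B" by (rule F(2))
    also have "L / \<delta> = 2 / \<rho> ^ k" using L by (simp add: \<delta>_def)
    also have "C * (2 / \<rho> ^ k) ^ card B = C * 2 ^ card B / (\<rho> ^ card B) ^ k"
      by (simp add: power_divide power_mult[symmetric] mult.commute)
    finally show ?thesis
      using \<rho> by (simp add: power_mult_distrib field_simps)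
  qed
  have "real (card T) * \<rho> ^ card B \<le> 1"
  proof (rule ccontr)
    assume "\<not> ?thesis"
    then obtain k where "C * 2 ^ card B < (real (card T) * \<rho> ^ card B) ^ k"
      using real_arch_pow[of "real (card T) * \<rho> ^ card B"] by auto
    then show False using bound[of k] by simp
  qed
  then have "real (card T) \<le> (1 / \<rho>) ^ card B"
    using \<rho> by (simp add: field_simps power_divide)
  also have "1 / \<rho> = 1 + 2 * R / \<epsilon>" using assms(7) by (simp add: \<rho>_def field_simps)
  finally show ?thesis .
qed

text \<open>A separated subset of maximal cardinality is a net: a point missed by it could be added.\<close>

lemma finite_net_if_separated_bounded:
  fixes Z :: "'a::metric_space set"
  assumes "0 < \<epsilon>"
    and bd: "\<And>T. finite T \<Longrightarrow> T \<subseteq> Z \<Longrightarrow> pairwise (\<lambda>x y. \<epsilon> \<le> dist x y) T \<Longrightarrow> real (card T) \<le> N"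
  obtains T where "finite T" "T \<subseteq> Z" "real (card T) \<le> N" "Z \<subseteq> (\<Union>t\<in>T. ball t \<epsilon>)"
proof -
  define Q where "Q T \<longleftrightarrow> finite T \<and> T \<subseteq> Z \<and> pairwise (\<lambda>x y. \<epsilon> \<le> dist x y) T" for T
  have "Q {}" by (simp add: Q_def)
  moreover have "\<forall>T. Q T \<longrightarrow> card T < Suc (nat \<lfloor>N\<rfloor>)"
    using bd by (auto simp: Q_def less_Suc_eq_le le_nat_floor)
  ultimately obtain T where T: "Q T" "\<And>T'. Q T' \<Longrightarrow> card T' \<le> card T"
    using ex_has_greatest_nat[of Q "{}" card] by blast
  have "\<exists>t\<in>T. dist t z < \<epsilon>" if z: "z \<in> Z" for z
  proof (rule ccontr)
    assume "\<not> ?thesis"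
    then have far: "\<epsilon> \<le> dist t z" if "t \<in> T" for t using that by force
    then have "z \<notin> T" using assms(1) by force
    moreover have "Q (insert z T)"
      using T(1) z far by (auto simp: Q_def pairwise_insert dist_commute)
    ultimately show False using T(2)[of "insert z T"] T(1) by (simp add: Q_def)
  qed
  then have "Z \<subseteq> (\<Union>t\<in>T. ball t \<epsilon>)" by auto
  then show ?thesis using that T(1) bd by (auto simp: Q_def)
qed

section \<open>Hausdorff dimension of a set covered self-similarly\<close>

text \<open>
  Keeping the centres in \<open>A\<close> is what allows the covering step to be applied again to each ball; the
  count \<open>n\<close> is that of an initial cover by unit balls.
\<close>

lemma iterate_ball_cover:
  fixes A :: "'a::metric_space set"
  assumes "compact A" "A \<subseteq> f ` A" "0 < \<theta>" "0 \<le> N"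
    and step: "\<And>x r. x \<in> A \<Longrightarrow> 0 < r \<Longrightarrow>
      \<exists>F\<subseteq>A. finite F \<and> real (card F) \<le> N \<and> f ` (A \<inter> ball x r) \<subseteq> (\<Union>y\<in>F. ball y (\<theta> * r))"
  obtains n where "\<And>k. \<exists>F\<subseteq>A. finite F \<and> real (card F) \<le> real n * N ^ k \<and>
                         A \<subseteq> (\<Union>y\<in>F. ball y (\<theta> ^ k))"
proof -
  obtain F0 where F0: "finite F0" "F0 \<subseteq> A" "A \<subseteq> (\<Union>x\<in>F0. ball x 1)"
    using compactE_image[OF assms(1), of A "\<lambda>x. ball x 1"] by force
  have "\<exists>F\<subseteq>A. finite F \<and> real (card F) \<le> real (card F0) * N ^ k \<and>
                         A \<subseteq> (\<Union>y\<in>F. ball y (\<theta> ^ k))" for k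
  proof (induction k)
    case 0
    show ?case using F0 by auto
  next
    case (Suc k)
    then obtain F where F: "F \<subseteq> A" "finite F" "real (card F) \<le> real (card F0) * N ^ k"
      "A \<subseteq> (\<Union>y\<in>F. ball y (\<theta> ^ k))" by blast
    have "\<forall>x\<in>F. \<exists>G\<subseteq>A. finite G \<and> real (card G) \<le> N \<and>
            f ` (A \<inter> ball x (\<theta> ^ k)) \<subseteq> (\<Union>y\<in>G. ball y (\<theta> * \<theta> ^ k))"
      using step F(1) assms(3) by (meson subsetD zero_less_power)
    then obtain G where G: "\<And>x. x \<in> F \<Longrightarrow> G x \<subseteq> A \<and> finite (G x) \<and> real (card (G x)) \<le> N \<and>
            f ` (A \<inter> ball x (\<theta> ^ k)) \<subseteq> (\<Union>y\<in>G x. ball y (\<theta> * \<theta> ^ k))" by metis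
    have "real (card (\<Union>x\<in>F. G x)) \<le> real (\<Sum>x\<in>F. card (G x))"
      using card_UN_le[OF F(2)] of_nat_le_iff by blast
    also have "\<dots> \<le> (\<Sum>x\<in>F. N)" unfolding of_nat_sum using G by (intro sum_mono) auto
    also have "\<dots> = real (card F) * N" by simp
    also have "\<dots> \<le> real (card F0) * N ^ k * N" using F(3) assms(4) by (intro mult_right_mono)
    finally have "real (card (\<Union>x\<in>F. G x)) \<le> real (card F0) * N ^ Suc k" by (simp add: mult_ac)
    moreover have "A \<subseteq> (\<Union>y\<in>(\<Union>x\<in>F. G x). ball y (\<theta> ^ Suc k))"
    proof
      fix a assume "a \<in> A"
      then obtain b where b: "b \<in> A" "a = f b" using assms(2) by blast
      then obtain x where x: "x \<in> F" "b \<in> ball x (\<theta> ^ k)" using F(4) by blast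
      then have "a \<in> f ` (A \<inter> ball x (\<theta> ^ k))" using b by blast
      then show "a \<in> (\<Union>y\<in>(\<Union>x\<in>F. G x). ball y (\<theta> ^ Suc k))" using G[OF x(1)] x(1) by fastforce
    qed
    moreover have "(\<Union>x\<in>F. G x) \<subseteq> A" "finite (\<Union>x\<in>F. G x)" using G F(2) by blast+
    ultimately show ?case by blast
  qed
  then show ?thesis using that by blast
qed

lemma hausdorff_content_le_finite_cover:
  fixes A :: "'a::metric_space set"
  assumes "finite F" "A \<subseteq> (\<Union>x\<in>F. ball x \<rho>)" "0 < \<rho>" "\<rho> \<le> \<epsilon>"
  shows "hausdorff_content A d \<epsilon> \<le> ennreal (real (card F) * \<rho> powr d)"
proof -
  obtain c where c: "bij_betw c {..<card F} F"
    using ex_bij_betw_nat_finite[OF assms(1)] by (auto simp: atLeast0LessThan)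
  have "(\<Sum>\<^sub>\<infinity>i\<in>{..<card F}. ennreal (\<rho> powr d)) = ennreal (real (card F) * \<rho> powr d)"
    by (simp add: ennreal_mult ennreal_of_nat_eq_real_of_nat)
  moreover have "A \<subseteq> (\<Union>i\<in>{..<card F}. ball (c i) \<rho>)"
  proof
    fix a assume "a \<in> A"
    then obtain x where x: "x \<in> F" "a \<in> ball x \<rho>" using assms(2) by blast
    then have "x \<in> c ` {..<card F}" by (simp only: bij_betw_imp_surj_on[OF c])
    then obtain i where "i \<in> {..<card F}" "x = c i" by (rule imageE)
    with x(2) show "a \<in> (\<Union>i\<in>{..<card F}. ball (c i) \<rho>)" by (intro UN_I) simp_all
  qed
  ultimately show ?thesis
    unfolding hausdorff_content_def using assms(3,4)
    by (intro Inf_lower CollectI exI[of _ "{..<card F}"] exI[of _ c] exI[of _ "\<lambda>_. \<rho>"]) auto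
qed

text \<open>
  The \<open>k\<close>-th cover contributes at most \<open>C (N \<theta>\<^sup>d)\<^sup>k\<close> to the content, which tends to \<open>0\<close>, while its
  radii eventually drop below any \<open>\<epsilon>\<close>. So the content vanishes at every scale, not only in the limit.
\<close>

lemma hausdorff_dim_le_if_geometric_covers:
  fixes A :: "'a::metric_space set"
  assumes covers: "\<And>k. \<exists>F. finite F \<and> real (card F) \<le> C * N ^ k \<and> A \<subseteq> (\<Union>y\<in>F. ball y (\<theta> ^ k))"
    and "0 < \<theta>" "\<theta> < 1" "0 \<le> d" "0 \<le> N" "N * \<theta> powr d < 1"
  shows "hausdorff_dim A \<le> ereal d"
proof -
  have content: "hausdorff_content A d \<epsilon> = 0" if "\<epsilon> > 0" for \<epsilon>
  proof -
    have "(\<lambda>k. C * (N * \<theta> powr d) ^ k) \<longlonglongrightarrow> C * 0"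
      using assms by (intro tendsto_mult tendsto_const LIMSEQ_power_zero) (simp add: abs_mult)
    then have lim: "(\<lambda>k. ennreal (C * (N * \<theta> powr d) ^ k)) \<longlonglongrightarrow> ennreal 0"
      by (intro tendsto_ennrealI) simp
    have "(\<lambda>k. \<theta> ^ k) \<longlonglongrightarrow> 0" using assms by (intro LIMSEQ_power_zero) simp
    then have "\<forall>\<^sub>F k in sequentially. \<theta> ^ k < \<epsilon>" using that by (rule order_tendstoD)
    then have "\<forall>\<^sub>F k in sequentially. hausdorff_content A d \<epsilon> \<le> ennreal (C * (N * \<theta> powr d) ^ k)"
    proof eventually_elim
      case (elim k)
      obtain F where F: "finite F" "real (card F) \<le> C * N ^ k" "A \<subseteq> (\<Union>y\<in>F. ball y (\<theta> ^ k))"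
        using covers by blast
      have "hausdorff_content A d \<epsilon> \<le> ennreal (real (card F) * (\<theta> ^ k) powr d)"
        using F elim assms(2) by (intro hausdorff_content_le_finite_cover) auto
      also have "\<dots> \<le> ennreal (C * N ^ k * (\<theta> ^ k) powr d)"
        using F(2) by (intro ennreal_leI mult_right_mono) auto
      also have "(\<theta> ^ k) powr d = (\<theta> powr d) ^ k"
        using assms(2) by (simp add: powr_realpow[symmetric] powr_powr mult.commute powr_power)
      finally show ?case by (simp add: power_mult_distrib mult_ac)
    qed
    then have "hausdorff_content A d \<epsilon> \<le> ennreal 0"
      by (intro tendsto_lowerbound[OF lim]) auto
    then show ?thesis by simp
  qed
  have "\<forall>\<^sub>F \<epsilon> in at_right 0. hausdorff_content A d \<epsilon> = 0"
    by (rule eventually_mono[OF eventually_at_right_less content])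
  then have "(hausdorff_content A d \<longlongrightarrow> 0) (at_right 0)"
    by (simp add: tendsto_eventually)
  then have "hausdorff_measure A d = 0"
    unfolding hausdorff_measure_def by (intro tendsto_Lim) auto
  then show ?thesis
    unfolding hausdorff_dim_def using assms(4) by (intro INF_lower) auto
qed

section \<open>One step of the dynamics\<close>

text \<open>
  Selecting the centres among the image points themselves, by maximal separation of their
  projections, avoids the factor \<open>2\<close> that recentring arbitrary covering balls in \<open>A\<close> would cost.
  The factor \<open>2\<close> in front of \<open>b\<close> comes from the distance of two points of \<open>ball x r\<close>, which is
  less than \<open>2 r\<close>.
\<close>

lemma image_ball_cover:
  fixes f P :: "'a::real_normed_vector \<Rightarrow> 'a"
  assumes "finite B" "independent B" "range P = span B"
    and fA: "f ` A \<subseteq> A"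
    and pos: "0 < a" "0 < b" "0 < \<alpha>"
    and Pf: "\<And>x y. x \<in> A \<Longrightarrow> y \<in> A \<Longrightarrow> norm (P (f x) - P (f y)) \<le> a * norm (x - y)"
    and Qf: "\<And>x y. x \<in> A \<Longrightarrow> y \<in> A \<Longrightarrow>
               norm ((f x - P (f x)) - (f y - P (f y))) \<le> b * norm (x - y)"
    and x: "x \<in> A" and r: "0 < r"
  shows "\<exists>F\<subseteq>A. finite F \<and> real (card F) \<le> (1 + 2 / \<alpha>) ^ card B \<and>
           f ` (A \<inter> ball x r) \<subseteq> (\<Union>y\<in>F. ball y ((\<alpha> * a + 2 * b) * r))"
proof -
  define Y where "Y = f ` (A \<inter> ball x r)"
  have sub: "P ` Y \<subseteq> span B \<inter> cball (P (f x)) (a * r)"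
  proof clarify
    fix y assume "y \<in> Y"
    then obtain z where z: "z \<in> A" "dist x z < r" "y = f z" by (auto simp: Y_def)
    have "norm (P (f x) - P (f z)) \<le> a * norm (x - z)" using Pf x z by blast
    also have "\<dots> \<le> a * r" using z pos by (simp add: dist_norm)
    finally show "P y \<in> span B \<inter> cball (P (f x)) (a * r)"
      using z assms(3) by (auto simp: dist_norm)
  qed
  have "\<alpha> * a * r > 0" using pos r by simp
  then obtain T where T: "finite T" "T \<subseteq> P ` Y" "real (card T) \<le> (1 + 2 / \<alpha>) ^ card B"
      "P ` Y \<subseteq> (\<Union>t\<in>T. ball t (\<alpha> * a * r))"
  proof (rule finite_net_if_separated_bounded[where Z = "P ` Y" and N = "(1 + 2 / \<alpha>) ^ card B"])
    fix T assume T: "finite T" "T \<subseteq> P ` Y" "pairwise (\<lambda>x y. \<alpha> * a * r \<le> dist x y) T"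
    have "real (card T) \<le> (1 + 2 * (a * r) / (\<alpha> * a * r)) ^ card B"
    proof (rule card_separated_in_ball_le[OF assms(1,2) T(1) _ _ _ _ T(3)])
      show "T \<subseteq> span B \<inter> cball (P (f x)) (a * r)" using T(2) sub by blast
      show "P (f x) \<in> span B" using assms(3) by blast
    qed (use pos r in auto)
    also have "2 * (a * r) / (\<alpha> * a * r) = 2 / \<alpha>" using pos r by simp
    finally show "real (card T) \<le> (1 + 2 / \<alpha>) ^ card B" .
  qed
  obtain F where F: "F \<subseteq> Y" "inj_on P F" "T = P ` F"
    using T(2) by (auto simp: subset_image_inj)
  have "finite F" using T(1) F finite_imageD by blast
  moreover have "card F = card T" using F by (simp add: card_image)
  moreover have "F \<subseteq> A" using F(1) fA by (auto simp: Y_def)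
  moreover have "Y \<subseteq> (\<Union>y\<in>F. ball y ((\<alpha> * a + 2 * b) * r))"
  proof
    fix y assume y: "y \<in> Y"
    then obtain w where w: "w \<in> F" "dist (P w) (P y) < \<alpha> * a * r" using T(4) F(3) by auto
    obtain u v where uv: "u \<in> A" "dist x u < r" "y = f u" "v \<in> A" "dist x v < r" "w = f v"
      using y w(1) F(1) unfolding Y_def by auto
    have "dist v u \<le> dist x v + dist x u" by (rule dist_triangle3)
    then have "norm (v - u) < 2 * r" using uv by (simp add: dist_norm)
    then have "b * norm (v - u) < b * (2 * r)" using pos by (intro mult_strict_left_mono)
    then have "norm ((w - P w) - (y - P y)) < 2 * b * r"
      using Qf[OF uv(4,1)] uv(3,6) by simp
    moreover have "dist w y \<le> norm (P w - P y) + norm ((w - P w) - (y - P y))"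
      using norm_triangle_ineq[of "P w - P y" "(w - P w) - (y - P y)"] by (simp add: dist_norm)
    ultimately have "dist w y < (\<alpha> * a + 2 * b) * r"
      using w(2) by (simp add: dist_norm algebra_simps)
    then show "y \<in> (\<Union>y\<in>F. ball y ((\<alpha> * a + 2 * b) * r))" using w(1) by auto
  qed
  ultimately show ?thesis
    using T(3) unfolding Y_def by (intro exI[of _ F] conjI) simp_all
qed

theorem theorem2p1:
  fixes S :: "real \<Rightarrow> 'a::banach \<Rightarrow> 'a"
    and A :: "'a set"
    and P :: "'a \<Rightarrow> 'a"
    and \<Lambda> :: nat
    and t\<^sub>0 M\<^sub>1 M\<^sub>2 M\<^sub>3 lam\<^sub>0 lam\<^sub>1 \<alpha> :: real
  assumes "continuous_semigroup S"
    and "global_attractor S A"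
    and "finite_rank_projection P"
    and "dim (range P) = \<Lambda>"
    and "\<Lambda> \<ge> 1"
    and "t\<^sub>0 > 0" and "M\<^sub>1 > 0" and "M\<^sub>2 > 0" and "M\<^sub>3 > 0"
    and "\<And>\<phi> \<psi>. \<phi> \<in> A \<Longrightarrow> \<psi> \<in> A \<Longrightarrow>
           norm (P (S t\<^sub>0 \<phi>) - P (S t\<^sub>0 \<psi>)) \<le> M\<^sub>1 * exp (lam\<^sub>0 * t\<^sub>0) * norm (\<phi> - \<psi>)"
    and "\<And>\<phi> \<psi>. \<phi> \<in> A \<Longrightarrow> \<psi> \<in> A \<Longrightarrow>
           norm ((S t\<^sub>0 \<phi> - P (S t\<^sub>0 \<phi>)) - (S t\<^sub>0 \<psi> - P (S t\<^sub>0 \<psi>)))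
             \<le> (M\<^sub>2 * exp (lam\<^sub>1 * t\<^sub>0) + M\<^sub>3 * exp (lam\<^sub>0 * t\<^sub>0)) * norm (\<phi> - \<psi>)"
    and "0 < \<alpha>" and "\<alpha> < 2"
    and "\<alpha> * M\<^sub>1 * exp (lam\<^sub>0 * t\<^sub>0) + 2 * M\<^sub>2 * exp (lam\<^sub>1 * t\<^sub>0) + 2 * M\<^sub>3 * exp (lam\<^sub>0 * t\<^sub>0) < 1"
  shows "hausdorff_dim A
           < ereal ((- ln (real \<Lambda>) - real \<Lambda> * ln (2 + 4 / \<alpha>))
               / ln (\<alpha> * M\<^sub>1 * exp (lam\<^sub>0 * t\<^sub>0) + 2 * M\<^sub>2 * exp (lam\<^sub>1 * t\<^sub>0) + 2 * M\<^sub>3 * exp (lam\<^sub>0 * t\<^sub>0)))"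
proof -
  define f where "f = S t\<^sub>0"
  define a where "a = M\<^sub>1 * exp (lam\<^sub>0 * t\<^sub>0)"
  define b where "b = M\<^sub>2 * exp (lam\<^sub>1 * t\<^sub>0) + M\<^sub>3 * exp (lam\<^sub>0 * t\<^sub>0)"
  define \<theta> where "\<theta> = \<alpha> * a + 2 * b"
  define N where "N = (1 + 2 / \<alpha>) ^ \<Lambda>"
  have \<theta>_eq: "\<alpha> * M\<^sub>1 * exp (lam\<^sub>0 * t\<^sub>0) + 2 * M\<^sub>2 * exp (lam\<^sub>1 * t\<^sub>0) + 2 * M\<^sub>3 * exp (lam\<^sub>0 * t\<^sub>0) = \<theta>"
    by (simp add: \<theta>_def a_def b_def algebra_simps)
  have pos: "a > 0" "b > 0" using assms by (simp_all add: a_def b_def add_pos_pos)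
  have \<theta>: "0 < \<theta>" "\<theta> < 1"
    using pos assms(12,14) \<theta>_eq by (simp_all add: \<theta>_def add_pos_pos)
  have cA: "compact A" and fA: "f ` A = A"
    using assms(2,6) by (auto simp: global_attractor_def invariant_set_def f_def)
  obtain B0 where B0: "finite B0" "range P = span B0"
    using assms(3) by (auto simp: finite_rank_projection_def)
  obtain B where B: "B \<subseteq> range P" "independent B" "range P \<subseteq> span B" "card B = \<Lambda>"
    using basis_exists[of "range P"] assms(4) by metis
  have "finite B" using independent_span_bound[OF B0(1) B(2)] B(1) B0(2) by simp
  moreover have "range P = span B"
    using B(1,3) B0(2) span_mono[OF B(1)] by (simp only: span_span subset_antisym)
  ultimately have step: "\<exists>F\<subseteq>A. finite F \<and> real (card F) \<le> N \<and>
      f ` (A \<inter> ball x r) \<subseteq> (\<Union>y\<in>F. ball y (\<theta> * r))" if "x \<in> A" "0 < r" for x r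
    using image_ball_cover[of B P f A a b \<alpha> x r] B(2,4) fA pos assms(10,11,12) that
    by (simp add: N_def \<theta>_def f_def a_def b_def)
  have N1: "N \<ge> 1" using assms(12) by (simp add: N_def)
  obtain n where n: "\<And>k. \<exists>F\<subseteq>A. finite F \<and> real (card F) \<le> real n * N ^ k \<and>
                         A \<subseteq> (\<Union>y\<in>F. ball y (\<theta> ^ k))"
    using iterate_ball_cover[OF cA _ \<theta>(1) _ step] fA N1 by auto
  have ln\<theta>: "ln \<theta> < 0" using \<theta> by simp
  have "ln N = \<Lambda> * ln (1 + 2 / \<alpha>)" using assms(12) by (simp add: N_def ln_realpow add_pos_pos)
  \<comment> \<open>Strictness is gained here: doubling \<open>1 + 2 / \<alpha>\<close> increases the logarithm, and
    \<open>\<Lambda> \<ge> 1\<close> keeps the increase.\<close>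
  also have "\<dots> < \<Lambda> * ln (2 + 4 / \<alpha>)"
    using assms(5,12) by (intro mult_strict_left_mono) (simp_all add: add_pos_pos field_simps)
  also have "\<dots> \<le> ln \<Lambda> + \<Lambda> * ln (2 + 4 / \<alpha>)" using assms(5) by simp
  finally have "ln N / (- ln \<theta>) < (ln \<Lambda> + \<Lambda> * ln (2 + 4 / \<alpha>)) / (- ln \<theta>)"
    using ln\<theta> by (intro divide_strict_right_mono) auto
  then obtain d where d: "ln N / (- ln \<theta>) < d" "d < (ln \<Lambda> + \<Lambda> * ln (2 + 4 / \<alpha>)) / (- ln \<theta>)"
    using dense by blast
  have "ln N / (- ln \<theta>) \<ge> 0" using N1 ln\<theta> by (intro divide_nonneg_pos) auto
  then have d0: "d \<ge> 0" using d(1) by simp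
  have "ln N + d * ln \<theta> < 0" using d(1) ln\<theta> by (simp add: field_simps)
  then have "exp (ln N + d * ln \<theta>) < 1" by simp
  then have "N * \<theta> powr d < 1" using N1 \<theta> by (simp add: exp_add powr_def)
  then have "hausdorff_dim A \<le> ereal d"
    using n \<theta> d0 N1 by (intro hausdorff_dim_le_if_geometric_covers[of "real n" N A \<theta>]) (blast, auto)
  also have "\<dots> < ereal ((- ln (real \<Lambda>) - real \<Lambda> * ln (2 + 4 / \<alpha>)) / ln \<theta>)"
    using d(2) ln\<theta> by (simp add: field_simps)
  finally show ?thesis unfolding \<theta>_eq .
qed

end
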